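(* Let $(X,d,\mu)$ be a metric space with a doubling Borel regular measure $\mu$ for which all open balls have positive and finite measure. Let $f\in L^1_{loc}(X)$. Then $f\in BMO(X)$ if and only if there exists $M\geq 0$ such that $$\int_{\{x\in B:|f(x)-f_B|>\lambda\}}|f-f_B|\,d\mu\leq(\lambda+M)\,\mu(\{x\in 3B:|f(x)-f_B|>\lambda\})$$ for all $\lambda\geq 0$ and all balls $B\subset X$.
   Context: Balls are open: $B=B(x,r)=\{y\in X:d(y,x)<r\}$, with given center $x$ and radius $r>0$, and $3B=B(x,3r)$. The measure $\mu$ is doubling if there is $c_\mu\geq 1$ with $\mu(B(x,2r))\leq c_\mu\mu(B(x,r))$ for all $x\in X$, $r>0$. Here $f\in L^1_{loc}(X)$ means that the real-valued function $f$ is measurable and integrable over every ball, and $f_B=\frac1{\mu(B)}\int_B f\,d\mu$. We write $f\in BMO(X)$ if $f\in L^1_{loc}(X)$ and there exists $M'\geq 0$ such that $\frac1{\mu(B)}\int_B|f-f_B|\,d\mu\leq M'$ for every ball $B\subset X$. *)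

theory Defs
  imports "HOL-Analysis.Analysis"
begin

text \<open>
  The metric space is the whole type \<open>'a :: metric_space\<close>. A Borel regular measure is often
  taken to be an outer measure, restricted to its Caratheodory measurable sets. Here a measure
  lives on a sigma-algebra that contains the Borel sets and may be strictly larger, which
  includes that case.
\<close>

definition borel_regular :: "'a::metric_space measure \<Rightarrow> bool" where
  "borel_regular \<mu> \<longleftrightarrow>
     sets borel \<subseteq> sets \<mu> \<and>
     (\<forall>A\<in>sets \<mu>. \<exists>B\<in>sets borel. A \<subseteq> B \<and> emeasure \<mu> B = emeasure \<mu> A)"

definition balls_pos_finite :: "'a::metric_space measure \<Rightarrow> bool" where
  "balls_pos_finite \<mu> \<longleftrightarrow>
     (\<forall>x. \<forall>r>0. 0 < emeasure \<mu> (ball x r) \<and> emeasure \<mu> (ball x r) < \<infinity>)"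

definition doubling :: "'a::metric_space measure \<Rightarrow> bool" where
  "doubling \<mu> \<longleftrightarrow>
     (\<exists>c::real. c \<ge> 1 \<and>
        (\<forall>x. \<forall>r>0. emeasure \<mu> (ball x (2 * r)) \<le> ennreal c * emeasure \<mu> (ball x r)))"

definition L1_loc :: "'a::metric_space measure \<Rightarrow> ('a \<Rightarrow> real) set" where
  "L1_loc \<mu> =
     {f. f \<in> borel_measurable \<mu> \<and> (\<forall>x. \<forall>r>0. set_integrable \<mu> (ball x r) f)}"

definition avg :: "'a measure \<Rightarrow> 'a set \<Rightarrow> ('a \<Rightarrow> real) \<Rightarrow> real" where
  "avg \<mu> B f = (1 / measure \<mu> B) * (LINT y:B|\<mu>. f y)"

definition BMO :: "'a::metric_space measure \<Rightarrow> ('a \<Rightarrow> real) set" where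
  "BMO \<mu> =
     {f \<in> L1_loc \<mu>. \<exists>M'\<ge>0. \<forall>x. \<forall>r>0.
        avg \<mu> (ball x r) (\<lambda>y. \<bar>f y - avg \<mu> (ball x r) f\<bar>) \<le> M'}"

end

theory Submission imports Defs begin

text \<open>
  Taking \<open>lam = 0\<close> gives one direction by doubling. For the other, it suffices to bound the
  integral over \<open>B\<close> of the excess \<open>max 0 (\<bar>f - f\<^sub>B\<bar> - lam)\<close> by a multiple of \<open>\<mu> E\<close>, where
  \<open>E = {y \<in> 3B. \<bar>f y - f\<^sub>B\<bar> > lam}\<close>. Replace \<open>E\<close> by an open set \<open>U\<close> with \<open>E \<subseteq> U \<subseteq> 3B\<close> of almost
  the same measure. If \<open>U\<close> is large compared with \<open>B\<close>, the oscillation bound on \<open>B\<close> is enough.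
  Otherwise each \<open>y \<in> B \<inter> E\<close> has a largest dyadic radius at which \<open>U\<close> fills half of the ball around \<open>y\<close>;
  it exists because \<open>U\<close> is open, so no density theorem is needed. A Vitali selection makes these
  balls disjoint, and on each ball enlarged eight times \<open>U\<close> fills less than half, which bounds
  the integral of the excess there by the measure of the part of \<open>U\<close> in the selected ball.
\<close>

section \<open>Vitali covering in a metric space\<close>

text \<open>Zorn's lemma is applied to disjoint subfamilies \<open>T\<close> with an extra
  invariant: a ball that meets \<open>T\<close> meets a member of at least half its radius. If some
  ball met no member of a maximal \<open>T\<close>, then a nearly largest such ball could be added.
  So every ball meets \<open>T\<close>, and the invariant gives the covering.\<close>

lemma Vitali_covering_balls:
  fixes rad :: "'a::metric_space \<Rightarrow> real"
  assumes pos: "\<And>x. x \<in> S \<Longrightarrow> 0 < rad x" and bound: "\<And>x. x \<in> S \<Longrightarrow> rad x \<le> R"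
  obtains T where "T \<subseteq> S" "disjoint_family_on (\<lambda>x. ball x (rad x)) T"
    "\<And>x. x \<in> S \<Longrightarrow> \<exists>y\<in>T. ball x (rad x) \<subseteq> ball y (5 * rad y)"
proof -
  define meets where "meets x y \<longleftrightarrow> ball x (rad x) \<inter> ball y (rad y) \<noteq> {}" for x y
  define \<A> where "\<A> = {T. T \<subseteq> S \<and> (\<forall>x\<in>T. \<forall>y\<in>T. x \<noteq> y \<longrightarrow> \<not> meets x y) \<and>
     (\<forall>x\<in>S. (\<exists>y\<in>T. meets x y) \<longrightarrow> (\<exists>y\<in>T. meets x y \<and> rad x \<le> 2 * rad y))}"
  have "\<Union>C \<in> \<A>" if C: "subset.chain \<A> C" for C
  proof -
    have sub: "C \<subseteq> \<A>" and chain: "\<And>X Y. X \<in> C \<Longrightarrow> Y \<in> C \<Longrightarrow> X \<subseteq> Y \<or> Y \<subseteq> X"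
      using C by (auto simp: subset_chain_def)
    \<comment> \<open>Disjointness concerns two members, which lie in a common set of the chain; the
      invariant concerns one member, so the set containing that member suffices.\<close>
    have "\<not> meets x y" if "x \<in> \<Union>C" "y \<in> \<Union>C" "x \<noteq> y" for x y
    proof -
      obtain X Y where XY: "X \<in> C" "Y \<in> C" "x \<in> X" "y \<in> Y"
        using \<open>x \<in> \<Union>C\<close> \<open>y \<in> \<Union>C\<close> by auto
      then obtain Z where "Z \<in> C" "x \<in> Z" "y \<in> Z"
        using chain[of X Y] by blast
      then show ?thesis
        using sub \<open>x \<noteq> y\<close> by (auto simp: \<A>_def)
    qed
    moreover have "\<exists>y\<in>\<Union>C. meets x y \<and> rad x \<le> 2 * rad y"
      if "x \<in> S" "y \<in> \<Union>C" "meets x y" for x y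
    proof -
      obtain X where "X \<in> C" "y \<in> X"
        using \<open>y \<in> \<Union>C\<close> by auto
      then have "X \<in> \<A>"
        using sub by auto
      with that \<open>y \<in> X\<close> have "\<exists>y\<in>X. meets x y \<and> rad x \<le> 2 * rad y"
        unfolding \<A>_def by blast
      with \<open>X \<in> C\<close> show ?thesis by auto
    qed
    moreover have "\<Union>C \<subseteq> S"
      using sub by (auto simp: \<A>_def)
    ultimately show ?thesis
      unfolding \<A>_def by blast
  qed
  from subset_Zorn'[OF this] obtain T where T: "T \<in> \<A>" and max: "\<And>X. X \<in> \<A> \<Longrightarrow> T \<subseteq> X \<Longrightarrow> X = T"
    by blast
  have all_meet: "\<exists>y\<in>T. meets x y" if "x \<in> S" for x
  proof (rule ccontr)
    define S' where "S' = {x \<in> S. \<forall>y\<in>T. \<not> meets x y}"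
    define s where "s = Sup (rad ` S')"
    assume "\<not> (\<exists>y\<in>T. meets x y)"
    with \<open>x \<in> S\<close> have x: "x \<in> S'"
      by (auto simp: S'_def)
    have bdd: "bdd_above (rad ` S')"
      using bound by (auto simp: S'_def bdd_above_def)
    have upper: "rad z \<le> s" if "z \<in> S'" for z
      unfolding s_def by (rule cSup_upper) (use that bdd in auto)
    have "s > 0"
      using upper[OF x] pos[OF \<open>x \<in> S\<close>] by linarith
    \<comment> \<open>The supremum \<open>s\<close> of the radii of balls missing \<open>T\<close>
      need not be attained, which is why the invariant allows a factor 2.\<close>
    then obtain z where z: "z \<in> S'" "s / 2 < rad z"
      using less_cSup_iff[OF _ bdd, of "s / 2"] x unfolding s_def[symmetric] by auto
    have "z \<in> S"
      using z by (simp add: S'_def)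
    have "meets z z"
      using pos[OF \<open>z \<in> S\<close>] unfolding meets_def by (metis Int_absorb ball_eq_empty not_le)
    then have "z \<notin> T"
      using z by (auto simp: S'_def)
    have sym: "meets a b \<longleftrightarrow> meets b a" for a b
      by (auto simp: meets_def)
    have "insert z T \<in> \<A>"
      unfolding \<A>_def mem_Collect_eq
    proof (intro conjI ballI impI)
      show "insert z T \<subseteq> S"
        using T \<open>z \<in> S\<close> by (auto simp: \<A>_def)
      show "\<not> meets a b" if "a \<in> insert z T" "b \<in> insert z T" "a \<noteq> b" for a b
        using that T z sym by (auto simp: \<A>_def S'_def)
      fix a assume a: "a \<in> S" "\<exists>y\<in>insert z T. meets a y"
      show "\<exists>y\<in>insert z T. meets a y \<and> rad a \<le> 2 * rad y"
      \<comment> \<open>A ball in \<open>S'\<close> can only meet the new member \<open>z\<close>,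
        and \<open>rad a \<le> s < 2 * rad z\<close>. Any other ball already meets \<open>T\<close>,
        where the invariant holds.\<close>
      proof (cases "a \<in> S'")
        case True
        then show ?thesis
          using a z upper[OF True] by (auto simp: S'_def)
      next
        case False
        then show ?thesis
          using a(1) T by (auto simp: S'_def \<A>_def)
      qed
    qed
    from max[OF this] \<open>z \<notin> T\<close> show False by auto
  qed
  show thesis
  proof
    show "T \<subseteq> S"
      using T by (auto simp: \<A>_def)
    show "disjoint_family_on (\<lambda>x. ball x (rad x)) T"
      using T by (auto simp: \<A>_def disjoint_family_on_def meets_def)
    fix x assume "x \<in> S"
    have "\<forall>x\<in>S. (\<exists>y\<in>T. meets x y) \<longrightarrow> (\<exists>y\<in>T. meets x y \<and> rad x \<le> 2 * rad y)"
      using T by (simp add: \<A>_def)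
    with all_meet \<open>x \<in> S\<close> obtain y where y: "y \<in> T" "meets x y" "rad x \<le> 2 * rad y"
      by blast
    then obtain w where w: "dist x w < rad x" "dist y w < rad y"
      by (auto simp: meets_def)
    \<comment> \<open>Through the common point \<open>w\<close>, a point of the ball around
      \<open>x\<close> is within \<open>rad y + 2 * rad x\<close> of \<open>y\<close>, and
      \<open>rad x \<le> 2 * rad y\<close> makes this at most \<open>5 * rad y\<close>.\<close>
    have "ball x (rad x) \<subseteq> ball y (5 * rad y)"
    proof
      fix v assume "v \<in> ball x (rad x)"
      then have "dist x v < rad x" by simp
      moreover have "dist y v \<le> dist y w + dist x w + dist x v"
        using dist_triangle[of y v w] dist_triangle[of w v x] by (simp add: dist_commute)
      ultimately show "v \<in> ball y (5 * rad y)"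
        using w y(3) by simp
    qed
    with y(1) show "\<exists>y\<in>T. ball x (rad x) \<subseteq> ball y (5 * rad y)" by blast
  qed
qed

section \<open>Approximation of Borel sets under a finite measure\<close>

text \<open>The remainders decrease to the empty set. This serves to replace a countable union of
  closed sets, which may fail to be closed, by a finite one.\<close>

lemma (in finite_measure) measure_countable_Union_approx:
  assumes "range A \<subseteq> sets M" "0 < e"
  obtains n :: nat where "measure M ((\<Union>i. A i) - (\<Union>i<n. A i)) < e"
proof -
  have "(\<lambda>n. measure M ((\<Union>i. A i) - (\<Union>i<n. A i))) \<longlonglongrightarrow>
    measure M (\<Inter>n. (\<Union>i. A i) - (\<Union>i<n. A i))"
  proof (rule finite_Lim_measure_decseq)
    show "decseq (\<lambda>n. (\<Union>i. A i) - (\<Union>i<n. A i))"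
      unfolding decseq_def by (intro allI impI Diff_mono UN_mono) auto
    show "range (\<lambda>n. (\<Union>i. A i) - (\<Union>i<n. A i)) \<subseteq> sets M"
      using assms(1) by (intro image_subsetI sets.Diff sets.countable_UN) auto
  qed
  moreover have "(\<Inter>n. (\<Union>i. A i) - (\<Union>i<n. A i)) = {}"
    by blast
  ultimately have "(\<lambda>n. measure M ((\<Union>i. A i) - (\<Union>i<n. A i))) \<longlonglongrightarrow> 0"
    by (simp only: measure_empty)
  then have "eventually (\<lambda>n. measure M ((\<Union>i. A i) - (\<Union>i<n. A i)) < e) sequentially"
    using \<open>0 < e\<close> by (rule order_tendstoD)
  then show thesis
    using that by (auto simp: eventually_sequentially)
qed

text \<open>The neighbourhoods of \<open>A\<close> of width \<open>1 / (n + 1)\<close> decrease to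
  \<open>A\<close> because \<open>A\<close> is closed, and finiteness gives continuity from
  above.\<close>

lemma closed_approx_open:
  fixes M :: "'a::metric_space measure"
  assumes "finite_measure M" "sets M = sets borel" "closed A" "0 < e"
  obtains U where "open U" "A \<subseteq> U" "measure M (U - A) < e"
proof -
  interpret finite_measure M by fact
  define U where "U n = (\<Union>x\<in>A. ball x (1 / real (Suc n)))" for n
  have opn: "open (U n)" and sub: "A \<subseteq> U n" for n
    by (auto simp: U_def intro!: bexI)
  have dec: "U n \<subseteq> U m" if "m \<le> n" for m n
  proof -
    have "1 / real (Suc n) \<le> 1 / real (Suc m)"
      using that by (simp add: field_simps)
    then show ?thesis
      unfolding U_def by (intro UN_mono subset_ball) auto
  qed
  have "(\<Inter>n. U n - A) = {}"
  proof -
    have "x \<in> A" if x: "\<And>n. x \<in> U n" for x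
    proof -
      have "\<exists>y\<in>A. dist y x < \<epsilon>" if \<epsilon>: "\<epsilon> > 0" for \<epsilon>
      proof -
        obtain n where "1 / real (Suc n) < \<epsilon>"
          by (rule nat_approx_posE[OF \<epsilon>])
        then show ?thesis
          using x[of n] by (force simp: U_def)
      qed
      then show ?thesis
        using \<open>closed A\<close> by (metis closed_approachable)
    qed
    then show ?thesis by auto
  qed
  moreover have "(\<lambda>n. measure M (U n - A)) \<longlonglongrightarrow> measure M (\<Inter>n. U n - A)"
    using opn \<open>closed A\<close> dec
    by (intro finite_Lim_measure_decseq) (auto simp: assms(2) decseq_def)
  ultimately have "(\<lambda>n. measure M (U n - A)) \<longlonglongrightarrow> 0"
    by (simp only: measure_empty)
  then have "eventually (\<lambda>n. measure M (U n - A) < e) sequentially"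
    using \<open>0 < e\<close> by (rule order_tendstoD)
  then obtain n where "measure M (U n - A) < e"
    by (auto simp: eventually_sequentially)
  then show thesis
    using that opn sub by blast
qed

text \<open>Induction over the sigma-algebra generated by the closed sets. Approximating from both
  sides at once makes the property stable under complements, which exchange the roles of
  \<open>F\<close> and \<open>U\<close>.\<close>

lemma borel_approx_closed_open:
  fixes M :: "'a::metric_space measure"
  assumes "finite_measure M" and sets: "sets M = sets borel" and "A \<in> sets borel" "0 < e"
  shows "\<exists>F U. closed F \<and> open U \<and> F \<subseteq> A \<and> A \<subseteq> U \<and> measure M (U - F) < e"
proof -
  interpret finite_measure M by fact
  have "A \<in> sigma_sets UNIV (Collect closed)"
    using \<open>A \<in> sets borel\<close> by (simp add: borel_eq_closed)
  then show ?thesis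
    using \<open>0 < e\<close>
  proof (induction arbitrary: e)
    case (Basic A)
    then show ?case
      using closed_approx_open[OF assms(1,2), of A e] by (metis mem_Collect_eq order_refl)
  next
    case Empty
    then show ?case
      by (intro exI[of _ "{}"]) auto
  next
    case (Compl A)
    obtain F U where "closed F" "open U" "F \<subseteq> A" "A \<subseteq> U" "measure M (U - F) < e"
      using Compl.IH[OF Compl.prems] by blast
    moreover have "- F - - U = U - F" by auto
    ultimately show ?case
      by (intro exI[of _ "- U"] exI[of _ "- F"]) (auto simp: closed_Compl open_Compl)
  next
    case (Union A)
    \<comment> \<open>Half of \<open>e\<close> is shared out over the gaps \<open>U i - F i\<close>;
      the other half pays for cutting the union of the \<open>F i\<close> down to finitely
      many.\<close>
    define d where "d i = e / 2 * (1 / 2) ^ Suc i" for i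
    have "d i > 0" for i
      using \<open>0 < e\<close> by (simp add: d_def)
    with Union.IH have "\<forall>i. \<exists>F U. closed F \<and> open U \<and> F \<subseteq> A i \<and> A i \<subseteq> U \<and> measure M (U - F) < d i"
      by blast
    then obtain F U where FU: "\<And>i. closed (F i)" "\<And>i. open (U i)" "\<And>i. F i \<subseteq> A i"
      "\<And>i. A i \<subseteq> U i" "\<And>i. measure M (U i - F i) < d i"
      by metis
    have sm: "F i \<in> sets M" "U i \<in> sets M" for i
      using FU by (auto simp: sets)
    obtain n where n: "measure M ((\<Union>i. F i) - (\<Union>i<n. F i)) < e / 2"
      by (rule measure_countable_Union_approx[of F "e / 2"]) (use \<open>0 < e\<close> sm in auto)
    have d_sums: "d sums (e / 2)"
      using sums_mult[OF power_half_series, of "e / 2"] unfolding d_def[abs_def] mult_1_right .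
    have summ: "summable (\<lambda>i. measure M (U i - F i))"
      using FU(5) by (intro summable_comparison_test'[OF sums_summable[OF d_sums]]) (auto simp: less_imp_le)
    have "measure M (\<Union>i. U i - F i) \<le> (\<Sum>i. measure M (U i - F i))"
      using sm by (intro finite_measure_subadditive_countably summ) auto
    also have "\<dots> \<le> e / 2"
      using sums_unique[OF d_sums] suminf_le[OF _ summ sums_summable[OF d_sums]] FU(5)
      by (simp add: less_imp_le)
    finally have "measure M (\<Union>i. U i - F i) \<le> e / 2" .
    moreover have "measure M ((\<Union>i. U i) - (\<Union>i<n. F i)) \<le>
        measure M ((\<Union>i. U i - F i) \<union> ((\<Union>i. F i) - (\<Union>i<n. F i)))"
      using sm by (intro finite_measure_mono sets.Un sets.Diff sets.countable_UN) auto
    moreover have "\<dots> \<le> measure M (\<Union>i. U i - F i) + measure M ((\<Union>i. F i) - (\<Union>i<n. F i))"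
      using sm by (intro measure_Un_le sets.Diff sets.countable_UN) auto
    ultimately have "measure M ((\<Union>i. U i) - (\<Union>i<n. F i)) < e"
      using n by linarith
    moreover have "closed (\<Union>i<n. F i)" "open (\<Union>i. U i)"
      using FU by auto
    moreover have "(\<Union>i<n. F i) \<subseteq> (\<Union>i. A i)" "(\<Union>i. A i) \<subseteq> (\<Union>i. U i)"
      by (intro UN_mono FU(3,4) subset_UNIV order_refl)+
    ultimately show ?case
      by (intro exI[of _ "\<Union>i<n. F i"] exI[of _ "\<Union>i. U i"] conjI)
  qed
qed

section \<open>Countability and summation for disjoint families\<close>

text \<open>Finite partial sums of the measures are bounded by the measure of \<open>V\<close>, so
  the family is summable and has only countably many nonzero terms. This supplies the countability
  of a Vitali selection, whose index set comes from Zorn's lemma.\<close>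

lemma countable_disjoint_family_on:
  assumes disj: "disjoint_family_on A I" and meas: "\<And>i. i \<in> I \<Longrightarrow> A i \<in> sets M"
    and sub: "\<And>i. i \<in> I \<Longrightarrow> A i \<subseteq> V" and V: "V \<in> fmeasurable M"
    and pos: "\<And>i. i \<in> I \<Longrightarrow> 0 < emeasure M (A i)"
  shows "countable I"
proof -
  have fm: "A i \<in> fmeasurable M" if "i \<in> I" for i
    using fmeasurableI2[OF V sub meas] that by blast
  have "(\<lambda>i. measure M (A i)) summable_on I"
  proof (rule nonneg_bdd_above_summable_on)
    have "(\<Sum>i\<in>F. measure M (A i)) \<le> measure M V" if F: "F \<subseteq> I" "finite F" for F
    proof -
      have "(\<Sum>i\<in>F. measure M (A i)) = measure M (\<Union>i\<in>F. A i)"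
        using F disj fm
        by (intro measure_finite_Union[symmetric])
          (auto simp: disjoint_family_on_def fmeasurable_def less_top)
      also have "\<dots> \<le> measure M V"
        using F fm sub V by (intro measure_mono_fmeasurable) (auto intro!: sets.finite_UN meas)
      finally show ?thesis .
    qed
    then show "bdd_above (sum (\<lambda>i. measure M (A i)) ` {F. F \<subseteq> I \<and> finite F})"
      by (auto simp: bdd_above_def)
  qed auto
  then have "countable {i\<in>I. measure M (A i) \<noteq> 0}"
    by (rule summable_countable_real)
  moreover have "{i\<in>I. measure M (A i) \<noteq> 0} = I"
  proof -
    have "measure M (A i) \<noteq> 0" if "i \<in> I" for i
      using pos[OF that] emeasure_eq_measure2[OF fm[OF that]] by auto
    then show ?thesis by auto
  qed
  ultimately show ?thesis by simp
qed

text \<open>Subadditivity on the left and additivity on the right turn termwise bounds into a bound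
  for the unions. The sets \<open>D i\<close> may overlap; only the \<open>A i\<close> must be
  disjoint.\<close>

lemma emeasure_UN_le_disjoint:
  assumes I: "countable I" and disj: "disjoint_family_on A I"
    and A: "\<And>i. i \<in> I \<Longrightarrow> A i \<in> sets M" and D: "\<And>i. i \<in> I \<Longrightarrow> D i \<in> sets N"
    and le: "\<And>i. i \<in> I \<Longrightarrow> emeasure N (D i) \<le> C * emeasure M (A i)"
  shows "emeasure N (\<Union>i\<in>I. D i) \<le> C * emeasure M (\<Union>i\<in>I. A i)"
proof -
  \<comment> \<open>Since \<open>to_nat_on I\<close> is injective on \<open>I\<close>, each
    \<open>A' n\<close> is empty or a single \<open>A i\<close>, so finite and infinite
    \<open>I\<close> are treated alike.\<close>
  define A' where "A' n = (\<Union>i\<in>{i\<in>I. to_nat_on I i = n}. A i)" for n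
  define D' where "D' n = (\<Union>i\<in>{i\<in>I. to_nat_on I i = n}. D i)" for n
  have cases: "{i\<in>I. to_nat_on I i = n} = {} \<or> (\<exists>i\<in>I. {i\<in>I. to_nat_on I i = n} = {i})" for n
    using inj_on_to_nat_on[OF I] unfolding inj_on_def by blast
  have sA: "A' n \<in> sets M" and sD: "D' n \<in> sets N" and le': "emeasure N (D' n) \<le> C * emeasure M (A' n)" for n
    using cases[of n] unfolding A'_def D'_def by (elim disjE bexE; simp only:; simp add: A D le)+
  have "disjoint_family A'"
    using disj by (fastforce simp: A'_def disjoint_family_on_def)
  have eqs: "(\<Union>i\<in>I. D i) = (\<Union>n. D' n)" "(\<Union>i\<in>I. A i) = (\<Union>n. A' n)"
    by (auto simp: A'_def D'_def)
  have "emeasure N (\<Union>n. D' n) \<le> (\<Sum>n. emeasure N (D' n))"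
    using sD by (intro emeasure_subadditive_countably) auto
  also have "\<dots> \<le> (\<Sum>n. C * emeasure M (A' n))"
    using le' by (intro suminf_le) auto
  also have "\<dots> = C * emeasure M (\<Union>n. A' n)"
    using sA \<open>disjoint_family A'\<close> by (simp add: suminf_emeasure image_subset_iff)
  finally show ?thesis by (simp only: eqs)
qed

section \<open>Doubling measures and their outer regularity\<close>

locale doubling_space =
  fixes \<mu> :: "'a::metric_space measure" and c :: real
  assumes borel_regular: "borel_regular \<mu>"
    and balls_pos_finite: "balls_pos_finite \<mu>"
    and c_ge_1: "1 \<le> c"
    and emeasure_double: "0 < r \<Longrightarrow> emeasure \<mu> (ball x (2 * r)) \<le> ennreal c * emeasure \<mu> (ball x r)"
begin

lemma borel_in_sets: "A \<in> sets borel \<Longrightarrow> A \<in> sets \<mu>"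
  using borel_regular by (auto simp: borel_regular_def)

lemma space_eq_UNIV [simp]: "space \<mu> = UNIV"
  using borel_in_sets[of UNIV] sets.sets_into_space by auto

lemma ball_in_sets [simp, measurable]: "ball x r \<in> sets \<mu>"
  by (rule borel_in_sets) simp

lemma ball_fmeasurable [simp]: "ball x r \<in> fmeasurable \<mu>"
proof (cases "0 < r")
  case True
  then show ?thesis
    using balls_pos_finite by (intro fmeasurableI) (auto simp: balls_pos_finite_def)
next
  case False
  then have "ball x r = {}" by simp
  then show ?thesis by (simp add: fmeasurable_def del: ball_eq_empty)
qed

lemma measure_ball_pos: "0 < r \<Longrightarrow> 0 < measure \<mu> (ball x r)"
  using balls_pos_finite by (auto simp: balls_pos_finite_def emeasure_eq_measure2)

lemma measure_double:
  assumes "0 < r"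
  shows "measure \<mu> (ball x (2 * r)) \<le> c * measure \<mu> (ball x r)"
  using emeasure_double[OF assms, of x] c_ge_1
  by (simp add: emeasure_eq_measure2 ennreal_mult'[symmetric])

lemma measure_double_power:
  assumes "0 < r"
  shows "measure \<mu> (ball x (2 ^ n * r)) \<le> c ^ n * measure \<mu> (ball x r)"
proof (induction n)
  case (Suc n)
  have "measure \<mu> (ball x (2 * (2 ^ n * r))) \<le> c * measure \<mu> (ball x (2 ^ n * r))"
    using assms by (intro measure_double) simp
  also have "\<dots> \<le> c * (c ^ n * measure \<mu> (ball x r))"
    using Suc c_ge_1 by (intro mult_left_mono) auto
  finally show ?case by (simp add: mult.assoc)
qed simp

text \<open>Borel regularity replaces \<open>A\<close> by a Borel set of the same measure. The
  restriction of \<mu> to \<open>V\<close> is a finite Borel measure, so the approximation by open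
  sets applies to it, and intersecting with \<open>V\<close> keeps the result inside
  \<open>V\<close>.\<close>

lemma outer_regular:
  assumes A: "A \<in> sets \<mu>" and V: "open V" "V \<in> fmeasurable \<mu>" "A \<subseteq> V" and "0 < e"
  obtains U where "open U" "A \<subseteq> U" "U \<subseteq> V" "measure \<mu> U < measure \<mu> A + e"
proof -
  obtain B where B: "B \<in> sets borel" "A \<subseteq> B" "emeasure \<mu> B = emeasure \<mu> A"
    using borel_regular A unfolding borel_regular_def by blast
  \<comment> \<open>Pushing forward along the identity cuts the possibly larger sigma-algebra of
    \<mu> down to the Borel sets.\<close>
  define N where "N = distr (density \<mu> (indicator V)) borel (\<lambda>x. x)"
  have [measurable]: "V \<in> sets \<mu>"
    using V by simp
  have N: "emeasure N C = emeasure \<mu> (V \<inter> C)" if "C \<in> sets borel" for C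
  proof -
    have "(\<lambda>x. x) \<in> measurable (density \<mu> (indicator V)) borel"
      by (rule measurableI) (auto intro: borel_in_sets)
    then show ?thesis
      unfolding N_def using that
      by (simp add: emeasure_distr emeasure_density borel_in_sets nn_integral_indicator
          indicator_inter_arith[symmetric] sets.Int)
  qed
  have "finite_measure N"
    using N[of UNIV] V(2) by (intro finite_measureI) (simp add: N_def fmeasurable_def less_top)
  moreover have "sets N = sets borel"
    by (simp add: N_def)
  ultimately obtain F U where FU: "closed F" "open U" "F \<subseteq> B" "B \<subseteq> U" "measure N (U - F) < e"
    using borel_approx_closed_open[of N B e] B(1) \<open>0 < e\<close> by blast
  have Bfin: "A \<in> fmeasurable \<mu>" "B \<in> fmeasurable \<mu>"
  proof -
    show "A \<in> fmeasurable \<mu>"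
      using fmeasurableI2[OF V(2,3) A] .
    then show "B \<in> fmeasurable \<mu>"
      using B by (auto simp: fmeasurable_def borel_in_sets)
  qed
  have UF: "V \<inter> (U - F) \<in> fmeasurable \<mu>"
    using FU V by (intro fmeasurableI2[OF V(2)]) (auto intro!: borel_in_sets)
  have "measure N (U - F) = measure \<mu> (V \<inter> (U - F))"
    using N[of "U - F"] FU by (simp add: measure_def)
  \<comment> \<open>Points of \<open>U\<close> outside \<open>B\<close> lie in \<open>U - F\<close>,
    because \<open>F \<subseteq> B\<close>.\<close>
  moreover have "measure \<mu> (U \<inter> V) \<le> measure \<mu> (B \<union> V \<inter> (U - F))"
    using FU V B UF Bfin by (intro measure_mono_fmeasurable fmeasurable.Un) (auto intro!: borel_in_sets)
  moreover have "\<dots> \<le> measure \<mu> B + measure \<mu> (V \<inter> (U - F))"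
    using UF Bfin by (intro measure_Un_le) auto
  moreover have "measure \<mu> B = measure \<mu> A"
    using B by (simp add: measure_def)
  ultimately have "measure \<mu> (U \<inter> V) < measure \<mu> A + e"
    using FU(5) by linarith
  then show thesis
    using that[of "U \<inter> V"] FU V B by auto
qed

section \<open>Deviation of a locally integrable function and its excess over a level\<close>

context
  fixes f :: "'a \<Rightarrow> real"
  assumes f: "f \<in> L1_loc \<mu>"
begin

lemma f_measurable [measurable]: "f \<in> borel_measurable \<mu>"
  using f by (simp add: L1_loc_def)

lemma level_set_in_sets [measurable]: "{y \<in> ball x r. lam < \<bar>f y - b\<bar>} \<in> sets \<mu>"
proof -
  have "{y \<in> ball x r. lam < \<bar>f y - b\<bar>} = ball x r \<inter> {y \<in> space \<mu>. lam < \<bar>f y - b\<bar>}"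
    by auto
  also have "\<dots> \<in> sets \<mu>"
    by measurable
  finally show ?thesis .
qed

lemma set_integrable_const_ball: "set_integrable \<mu> (ball x r) (\<lambda>y. b::real)"
  using ball_fmeasurable[of x r] by (simp add: set_integrable_def fmeasurable_def)

lemma set_integrable_deviation:
  assumes "0 < r"
  shows "set_integrable \<mu> (ball x r) (\<lambda>y. \<bar>f y - b\<bar>)"
proof -
  have "set_integrable \<mu> (ball x r) f"
    using f assms by (simp add: L1_loc_def)
  then show ?thesis
    using set_integrable_const_ball by (intro set_integrable_abs set_integral_diff)
qed

lemma set_integrable_excess:
  assumes "0 < r" "0 \<le> lam"
  shows "set_integrable \<mu> (ball x r) (\<lambda>y. max 0 (\<bar>f y - b\<bar> - lam))"
  using set_integrable_deviation[OF assms(1), of x b] unfolding set_integrable_def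
proof (rule Bochner_Integration.integrable_bound)
  show "(\<lambda>y. indicator (ball x r) y *\<^sub>R max 0 (\<bar>f y - b\<bar> - lam)) \<in> borel_measurable \<mu>"
    by measurable
qed (use assms in \<open>auto simp: indicator_def\<close>)

text \<open>The excess is a 1-Lipschitz function of \<open>f\<close>, so its value at the mean of \<open>f\<close> over the
  ball is controlled by the oscillation as soon as it vanishes on half of the ball.\<close>

lemma excess_on_sparse_ball:
  assumes r: "0 < r" and lam: "0 \<le> lam"
    and osc: "(LINT y:ball x r|\<mu>. \<bar>f y - avg \<mu> (ball x r) f\<bar>) \<le> M * measure \<mu> (ball x r)"
    and U: "U \<in> sets \<mu>" "2 * measure \<mu> (U \<inter> ball x r) \<le> measure \<mu> (ball x r)"
    and vanish: "\<And>y. y \<in> ball x r - U \<Longrightarrow> \<bar>f y - a\<bar> \<le> lam"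
  shows "(LINT y:ball x r|\<mu>. max 0 (\<bar>f y - a\<bar> - lam)) \<le> 3 * M * measure \<mu> (ball x r)"
proof -
  define D where "D = ball x r"
  define b where "b = avg \<mu> D f"
  define p where "p = max 0 (\<bar>b - a\<bar> - lam)"
  have D: "D \<in> fmeasurable \<mu>" and intb: "set_integrable \<mu> D (\<lambda>y. \<bar>f y - b\<bar>)"
    using set_integrable_deviation[OF r] by (simp_all add: D_def)
  have osc': "(LINT y:D|\<mu>. \<bar>f y - b\<bar>) \<le> M * measure \<mu> D"
    using osc by (simp add: b_def D_def)
  have DU: "D - U \<in> fmeasurable \<mu>"
    using D U by (intro fmeasurable.Diff fmeasurable_Diff) auto
  have "measure \<mu> (D - U) = measure \<mu> D - measure \<mu> (U \<inter> D)"
    using measure_Diff[of \<mu> D "U \<inter> D"] D U by (simp add: fmeasurable_def Diff_Int less_top)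
  \<comment> \<open>Off \<open>U\<close> the bound \<open>\<bar>f y - a\<bar> \<le> lam\<close>
    forces \<open>p \<le> \<bar>f y - b\<bar>\<close>. As \<open>D - U\<close> is at least half of
    \<open>D\<close>, integrating gives
    \<open>p * measure \<mu> D \<le> 2 * M * measure \<mu> D\<close>.\<close>
  then have "p * (measure \<mu> D / 2) \<le> p * measure \<mu> (D - U)"
    using U(2) by (intro mult_left_mono) (auto simp: p_def D_def)
  also have "\<dots> = (LINT y|\<mu>. indicator (D - U) y * p)"
    by simp
  also have "\<dots> \<le> (LINT y:D|\<mu>. \<bar>f y - b\<bar>)"
    unfolding set_lebesgue_integral_def
  proof (rule integral_mono)
    show "integrable \<mu> (\<lambda>y. indicator (D - U) y * p)"
      using DU by (simp add: fmeasurable_def)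
    show "integrable \<mu> (\<lambda>y. indicator D y *\<^sub>R \<bar>f y - b\<bar>)"
      using intb by (simp add: set_integrable_def)
    fix y
    show "indicator (D - U) y * p \<le> indicator D y *\<^sub>R \<bar>f y - b\<bar>"
      using vanish[of y] by (auto simp: indicator_def D_def p_def)
  qed
  finally have p: "p * measure \<mu> D \<le> 2 * M * measure \<mu> D"
    using osc' by simp
  \<comment> \<open>The constant \<open>3 * M\<close> arises as \<open>2 * M\<close> from
    \<open>p\<close> and \<open>M\<close> from the oscillation.\<close>
  have "(LINT y:D|\<mu>. max 0 (\<bar>f y - a\<bar> - lam)) \<le> (LINT y:D|\<mu>. p + \<bar>f y - b\<bar>)"
    using set_integrable_excess[OF r lam] intb set_integrable_const_ball
    by (intro set_integral_mono) (auto simp: p_def D_def intro!: set_integral_add)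
  also have "\<dots> = p * measure \<mu> D + (LINT y:D|\<mu>. \<bar>f y - b\<bar>)"
    using intb set_integrable_const_ball D
    by (subst set_integral_add) (auto simp: D_def set_lebesgue_integral_def)
  finally show ?thesis
    using p osc' unfolding D_def by linarith
qed


section \<open>The stopping-radius estimate\<close>

text \<open>The constant is a product: 3 from a ball on which \<open>U\<close> is sparse,
  \<open>c ^ 3\<close> from shrinking that ball eightfold, and 2 because \<open>U\<close> fills half
  of the shrunken ball.\<close>

lemma excess_le_open_superset:
  assumes M: "0 \<le> M"
    and osc: "\<And>x r. 0 < r \<Longrightarrow>
      (LINT y:ball x r|\<mu>. \<bar>f y - avg \<mu> (ball x r) f\<bar>) \<le> M * measure \<mu> (ball x r)"
    and r: "0 < r" and lam: "0 \<le> lam" and a: "a = avg \<mu> (ball x r) f"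
    and U: "open U" "U \<subseteq> ball x (3 * r)" "{y \<in> ball x (3 * r). lam < \<bar>f y - a\<bar>} \<subseteq> U"
  shows "(LINT y:ball x r|\<mu>. max 0 (\<bar>f y - a\<bar> - lam)) \<le> 6 * c ^ 3 * M * measure \<mu> U"
\<comment> \<open>The threshold is chosen so that its failure excludes stopping at
  \<open>k = 0, 1, 2\<close>.\<close>
proof (cases "measure \<mu> (ball x r) \<le> 2 * c ^ 2 * measure \<mu> U")
  case True
  have "(LINT y:ball x r|\<mu>. max 0 (\<bar>f y - a\<bar> - lam)) \<le> (LINT y:ball x r|\<mu>. \<bar>f y - a\<bar>)"
    using set_integrable_excess[OF r lam] set_integrable_deviation[OF r] lam
    by (intro set_integral_mono) auto
  also have "\<dots> \<le> M * measure \<mu> (ball x r)"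
    using osc[OF r] by (simp add: a)
  also have "\<dots> \<le> M * (2 * c ^ 2 * measure \<mu> U)"
    using True M by (intro mult_left_mono)
  also have "\<dots> = (2 * c ^ 2) * (M * measure \<mu> U)"
    by simp
  also have "\<dots> \<le> (6 * c ^ 3) * (M * measure \<mu> U)"
    using M c_ge_1 power_increasing[of 2 3 c] by (intro mult_right_mono mult_mono) auto
  finally show ?thesis by (simp add: mult.assoc)
next
  case False
  \<comment> \<open>The radii start at \<open>2 * r\<close>, the largest for which a ball centred in
    \<open>ball x r\<close> surely lies in \<open>ball x (3 * r)\<close>. The least dense
    \<open>k\<close> gives the largest dense radius.\<close>
  define dense where "dense y k \<longleftrightarrow>
    measure \<mu> (ball y (2 * r / 2 ^ k)) \<le> 2 * measure \<mu> (U \<inter> ball y (2 * r / 2 ^ k))" for y and k :: nat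
  define S where "S = {y \<in> ball x r. lam < \<bar>f y - a\<bar>}"
  define k where "k y = (LEAST k. dense y k)" for y
  define rad where "rad y = 2 * r / 2 ^ k y" for y
  have Uf: "U \<in> fmeasurable \<mu>" and [measurable]: "U \<in> sets \<mu>"
    using fmeasurableI2[OF ball_fmeasurable U(2)] borel_in_sets[of U] U(1) by auto
  have UBf: "U \<inter> ball y s \<in> fmeasurable \<mu>" for y s
    using Uf by (intro fmeasurableI2[OF Uf]) auto
  have S_U: "S \<subseteq> U"
    using U(3) r by (auto simp: S_def)
  have dense_k: "dense y (k y)" if "y \<in> S" for y
  proof -
    have "y \<in> U"
      using S_U that by blast
    then obtain s where s: "0 < s" "ball y s \<subseteq> U"
      by (rule openE[OF U(1)])
    have "\<exists>n. 2 * r / s < 2 ^ n"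
      by (rule real_arch_pow) simp
    then obtain n where "2 * r / s < 2 ^ n" ..
    then have "2 * r / 2 ^ n < s"
      using s(1) by (simp add: field_simps)
    then have "ball y (2 * r / 2 ^ n) \<subseteq> U"
      using s(2) subset_ball[of "2 * r / 2 ^ n" s y] by auto
    then have "dense y n"
      by (simp add: dense_def Int_absorb1)
    then show ?thesis
      unfolding k_def by (rule LeastI)
  qed
  \<comment> \<open>Stopping earlier would give \<open>r / 2 \<le> rad y\<close>. Then
    \<open>ball x r\<close> lies in \<open>ball y (2 * r)\<close>, and two doublings together with
    density bound its measure by \<open>2 * c ^ 2 * measure \<mu> U\<close>.\<close>
  have k_ge_3: "3 \<le> k y" if "y \<in> S" for y
  proof (rule ccontr)
    assume "\<not> 3 \<le> k y"
    then have "(2::real) ^ k y \<le> 2 ^ 2"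
      by (intro power_increasing) auto
    then have "r / 2 \<le> rad y"
      using r by (simp add: rad_def field_simps)
    have "dist x y < r"
      using that by (simp add: S_def)
    have "ball x r \<subseteq> ball y (2 ^ 2 * (r / 2))"
    proof
      fix z assume "z \<in> ball x r"
      then show "z \<in> ball y (2 ^ 2 * (r / 2))"
        using \<open>dist x y < r\<close> dist_triangle[of y z x] by (simp add: dist_commute)
    qed
    then have "measure \<mu> (ball x r) \<le> measure \<mu> (ball y (2 ^ 2 * (r / 2)))"
      by (intro measure_mono_fmeasurable) auto
    also have "\<dots> \<le> c ^ 2 * measure \<mu> (ball y (r / 2))"
      using r by (intro measure_double_power) simp
    also have "\<dots> \<le> c ^ 2 * measure \<mu> (ball y (rad y))"
      using \<open>r / 2 \<le> rad y\<close> by (intro mult_left_mono measure_mono_fmeasurable subset_ball) auto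
    also have "\<dots> \<le> c ^ 2 * (2 * measure \<mu> (U \<inter> ball y (rad y)))"
      using dense_k[OF that] by (intro mult_left_mono) (auto simp: dense_def rad_def)
    also have "\<dots> \<le> c ^ 2 * (2 * measure \<mu> U)"
      using Uf by (intro mult_left_mono measure_mono_fmeasurable) auto
    finally show False
      using False by simp
  qed
  have rad_pos: "0 < rad y" for y
    using r by (simp add: rad_def)
  \<comment> \<open>The Vitali factor 5 is rounded up to the power of two 8, so the enlarged radius
    is again one of the tested radii and minimality of \<open>k y\<close> makes \<open>U\<close>
    sparse there.\<close>
  have rad8: "8 * rad y = 2 * r / 2 ^ (k y - 3)" if "y \<in> S" for y
  proof -
    have "(2::real) ^ k y = 8 * 2 ^ (k y - 3)"
      using k_ge_3[OF that] power_add[of "2::real" 3 "k y - 3"] by simp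
    then show ?thesis
      by (simp add: rad_def)
  qed
  have rad8_le: "8 * rad y \<le> 2 * r" if "y \<in> S" for y
    using r rad8[OF that] by (simp add: divide_le_eq)
  have sparse: "2 * measure \<mu> (U \<inter> ball y (8 * rad y)) \<le> measure \<mu> (ball y (8 * rad y))"
    if "y \<in> S" for y
  proof -
    have "\<not> dense y (k y - 3)"
      using k_ge_3[OF that] unfolding k_def by (intro not_less_Least) linarith
    then show ?thesis
      using rad8[OF that] by (simp add: dense_def)
  qed
  obtain T where T: "T \<subseteq> S" "disjoint_family_on (\<lambda>y. ball y (rad y)) T"
    "\<And>y. y \<in> S \<Longrightarrow> \<exists>z\<in>T. ball y (rad y) \<subseteq> ball z (5 * rad z)"
  proof (rule Vitali_covering_balls[of S rad "2 * r"])
    show "rad y \<le> 2 * r" if "y \<in> S" for y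
      using rad8_le[OF that] rad_pos[of y] by linarith
  qed (use rad_pos in auto)
  define A where "A y = U \<inter> ball y (rad y)" for y
  define D where "D y = ball y (8 * rad y)" for y
  \<comment> \<open>Treating the integral of the excess as a measure makes countable subadditivity
    available for the overlapping balls \<open>D y\<close>.\<close>
  define N where "N = density \<mu> (\<lambda>y. ennreal (max 0 (\<bar>f y - a\<bar> - lam)))"
  have A_disj: "disjoint_family_on A T"
    using T(2) by (fastforce simp: A_def disjoint_family_on_def)
  have A_large: "measure \<mu> (ball y (rad y)) \<le> 2 * measure \<mu> (A y)" if "y \<in> S" for y
    using dense_k[OF that] by (simp add: dense_def rad_def A_def)
  have Af: "A y \<in> fmeasurable \<mu>" for y
    using UBf by (simp add: A_def)
  \<comment> \<open>Each \<open>A y\<close> has at least half the measure of its ball, hence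
    positive measure, and all of them lie in \<open>U\<close>, which has finite measure.\<close>
  have "countable T"
  proof (rule countable_disjoint_family_on[OF A_disj])
    show "A y \<subseteq> U" "A y \<in> sets \<mu>" for y
      by (auto simp: A_def)
    show "0 < emeasure \<mu> (A y)" if "y \<in> T" for y
      using A_large[of y] that T(1) measure_ball_pos[OF rad_pos[of y], of y]
      by (auto simp: emeasure_eq_measure2[OF Af])
  qed (rule Uf)
  have N_ball: "emeasure N (ball z s) = ennreal (LINT y:ball z s|\<mu>. max 0 (\<bar>f y - a\<bar> - lam))"
    if "0 < s" for z s
  proof -
    have "emeasure N (ball z s) =
        (\<integral>\<^sup>+y. ennreal (indicator (ball z s) y *\<^sub>R max 0 (\<bar>f y - a\<bar> - lam)) \<partial>\<mu>)"
      unfolding N_def by (subst emeasure_density) (auto intro!: nn_integral_cong simp: indicator_def)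
    also have "\<dots> = ennreal (LINT y:ball z s|\<mu>. max 0 (\<bar>f y - a\<bar> - lam))"
      using set_integrable_excess[OF that lam] unfolding set_lebesgue_integral_def set_integrable_def
      by (intro nn_integral_eq_integral) auto
    finally show ?thesis .
  qed
  have N_D: "emeasure N (D y) \<le> ennreal (6 * c ^ 3 * M) * emeasure \<mu> (A y)" if "y \<in> T" for y
  proof -
    have "y \<in> S" using that T(1) by auto
    \<comment> \<open>The hypothesis on \<open>U\<close> controls \<open>f\<close> only inside the
      tripled ball, so the enlarged balls must stay there.\<close>
    have "D y \<subseteq> ball x (3 * r)"
    proof
      fix z assume "z \<in> D y"
      then show "z \<in> ball x (3 * r)"
        using rad8_le[OF \<open>y \<in> S\<close>] \<open>y \<in> S\<close> dist_triangle[of x z y]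
        by (simp add: D_def S_def)
    qed
    then have "\<bar>f z - a\<bar> \<le> lam" if "z \<in> D y - U" for z
      using that U(3) by force
    then have "(LINT y:D y|\<mu>. max 0 (\<bar>f y - a\<bar> - lam)) \<le> 3 * M * measure \<mu> (D y)"
      using rad_pos[of y] sparse[OF \<open>y \<in> S\<close>] unfolding D_def
      by (intro excess_on_sparse_ball[where U = U] lam osc) auto
    also have "\<dots> \<le> 3 * M * (c ^ 3 * measure \<mu> (ball y (rad y)))"
      using measure_double_power[OF rad_pos, of y 3 y] M by (intro mult_left_mono) (auto simp: D_def)
    also have "\<dots> \<le> 3 * M * (c ^ 3 * (2 * measure \<mu> (A y)))"
      using A_large[OF \<open>y \<in> S\<close>] c_ge_1 M by (intro mult_left_mono) auto
    finally have "(LINT y:D y|\<mu>. max 0 (\<bar>f y - a\<bar> - lam)) \<le> 6 * c ^ 3 * M * measure \<mu> (A y)"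
      using M by (simp add: mult_ac)
    then have "emeasure N (D y) \<le> ennreal (6 * c ^ 3 * M * measure \<mu> (A y))"
      using N_ball[of "8 * rad y" y] rad_pos[of y] by (simp add: D_def ennreal_leI)
    also have "\<dots> = ennreal (6 * c ^ 3 * M) * emeasure \<mu> (A y)"
      using M c_ge_1 by (simp add: emeasure_eq_measure2[OF Af] ennreal_mult'')
    finally show ?thesis .
  qed
  have UD: "(\<Union>y\<in>T. D y) \<in> sets \<mu>"
    by (intro borel_in_sets borel_open) (auto simp: D_def)
  have cover: "S \<subseteq> (\<Union>y\<in>T. D y)"
  proof
    fix y assume "y \<in> S"
    then obtain z where z: "z \<in> T" "ball y (rad y) \<subseteq> ball z (5 * rad z)"
      using T(3) by blast
    moreover have "y \<in> ball y (rad y)"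
      using rad_pos by simp
    moreover have "ball z (5 * rad z) \<subseteq> D z"
      using rad_pos[of z] unfolding D_def by (intro subset_ball) simp
    ultimately show "y \<in> (\<Union>y\<in>T. D y)" by blast
  qed
  have "\<bar>f y - a\<bar> \<le> lam" if "y \<in> ball x r" "y \<notin> (\<Union>y\<in>T. D y)" for y
    using that cover by (force simp: S_def)
  then have "emeasure N (ball x r) \<le> emeasure N (\<Union>y\<in>T. D y)"
    unfolding N_def using UD
    by (auto simp: emeasure_density indicator_def ennreal_eq_0_iff intro!: nn_integral_mono)
  also have "\<dots> \<le> ennreal (6 * c ^ 3 * M) * emeasure \<mu> (\<Union>y\<in>T. A y)"
    using Af N_D by (intro emeasure_UN_le_disjoint[OF \<open>countable T\<close> A_disj])
      (auto simp: N_def D_def)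
  also have "\<dots> \<le> ennreal (6 * c ^ 3 * M) * emeasure \<mu> U"
    by (intro mult_left_mono emeasure_mono) (auto simp: A_def)
  also have "\<dots> = ennreal (6 * c ^ 3 * M * measure \<mu> U)"
    using M c_ge_1 by (simp add: emeasure_eq_measure2[OF Uf] ennreal_mult'')
  finally show ?thesis
    using M c_ge_1 by (simp add: N_ball[OF r])
qed

section \<open>The level-set inequality and the equivalence\<close>

text \<open>On the level set the deviation is the excess plus \<open>lam\<close>. The excess is
  bounded through open supersets of the level set in the tripled ball, and the constant part by
  monotonicity.\<close>

lemma level_set_inequality:
  assumes M: "0 \<le> M"
    and osc: "\<And>x r. 0 < r \<Longrightarrow>
      (LINT y:ball x r|\<mu>. \<bar>f y - avg \<mu> (ball x r) f\<bar>) \<le> M * measure \<mu> (ball x r)"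
    and r: "0 < r" and lam: "0 \<le> lam" and a: "a = avg \<mu> (ball x r) f"
  shows "(LINT y:{y \<in> ball x r. \<bar>f y - a\<bar> > lam}|\<mu>. \<bar>f y - a\<bar>)
    \<le> (lam + 6 * c ^ 3 * M) * measure \<mu> {y \<in> ball x (3 * r). \<bar>f y - a\<bar> > lam}"
proof -
  define K where "K = 6 * c ^ 3 * M"
  define S where "S = {y \<in> ball x r. \<bar>f y - a\<bar> > lam}"
  define E where "E = {y \<in> ball x (3 * r). \<bar>f y - a\<bar> > lam}"
  have K: "0 \<le> K"
    using M c_ge_1 by (simp add: K_def)
  \<comment> \<open>\<open>measure\<close> is 0 on sets of infinite measure, so its monotonicity
    needs the finiteness that \<open>E\<close> and \<open>S\<close> inherit from balls.\<close>
  have "E \<in> sets \<mu>" "S \<in> sets \<mu>"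
    unfolding E_def S_def by (rule level_set_in_sets)+
  moreover have "E \<subseteq> ball x (3 * r)" "S \<subseteq> ball x r"
    by (auto simp: E_def S_def)
  ultimately have Ef: "E \<in> fmeasurable \<mu>" and Sf: "S \<in> fmeasurable \<mu>"
    using fmeasurableI2[OF ball_fmeasurable] by blast+
  have excess: "(LINT y:ball x r|\<mu>. max 0 (\<bar>f y - a\<bar> - lam)) \<le> K * measure \<mu> E"
  proof (rule field_le_epsilon)
    fix e :: real assume "0 < e"
    \<comment> \<open>Dividing by \<open>K + 1\<close> covers \<open>K = 0\<close>, and
      \<open>K * (e / (K + 1)) \<le> e\<close>.\<close>
    obtain U where U: "open U" "E \<subseteq> U" "U \<subseteq> ball x (3 * r)" "measure \<mu> U < measure \<mu> E + e / (K + 1)"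
      by (rule outer_regular[of E "ball x (3 * r)" "e / (K + 1)"])
        (use \<open>E \<in> sets \<mu>\<close> \<open>0 < e\<close> K in \<open>auto simp: E_def\<close>)
    have "(LINT y:ball x r|\<mu>. max 0 (\<bar>f y - a\<bar> - lam)) \<le> K * measure \<mu> U"
      unfolding K_def using U
      by (intro excess_le_open_superset[OF M osc r lam a]) (auto simp: E_def)
    also have "\<dots> \<le> K * (measure \<mu> E + e / (K + 1))"
      using U(4) K by (intro mult_left_mono) auto
    also have "\<dots> \<le> K * measure \<mu> E + e"
      using K \<open>0 < e\<close> by (simp add: field_simps)
    finally show "(LINT y:ball x r|\<mu>. max 0 (\<bar>f y - a\<bar> - lam)) \<le> K * measure \<mu> E + e" .
  qed
  have "(LINT y:S|\<mu>. \<bar>f y - a\<bar>) =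
      (LINT y|\<mu>. indicator (ball x r) y *\<^sub>R max 0 (\<bar>f y - a\<bar> - lam) + indicator S y * lam)"
    unfolding set_lebesgue_integral_def
    by (intro Bochner_Integration.integral_cong) (auto simp: S_def indicator_def)
  also have "\<dots> = (LINT y:ball x r|\<mu>. max 0 (\<bar>f y - a\<bar> - lam)) + lam * measure \<mu> S"
    using set_integrable_excess[OF r lam, of x a] Sf
    unfolding set_lebesgue_integral_def set_integrable_def
    by (subst Bochner_Integration.integral_add) (auto simp: fmeasurable_def)
  also have "\<dots> \<le> K * measure \<mu> E + lam * measure \<mu> E"
    using r lam Sf Ef excess
    by (intro add_mono mult_left_mono measure_mono_fmeasurable) (auto simp: S_def E_def)
  finally show ?thesis
    by (simp add: K_def S_def E_def algebra_simps)
qed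

lemma BMO_iff:
  "f \<in> BMO \<mu> \<longleftrightarrow> (\<exists>M\<ge>0. \<forall>x. \<forall>r>0.
    (LINT y:ball x r|\<mu>. \<bar>f y - avg \<mu> (ball x r) f\<bar>) \<le> M * measure \<mu> (ball x r))"
proof -
  have "avg \<mu> (ball x r) (\<lambda>y. \<bar>f y - avg \<mu> (ball x r) f\<bar>) \<le> M \<longleftrightarrow>
      (LINT y:ball x r|\<mu>. \<bar>f y - avg \<mu> (ball x r) f\<bar>) \<le> M * measure \<mu> (ball x r)"
    if "0 < r" for x r M
    using measure_ball_pos[OF that, of x]
    unfolding avg_def[of \<mu> "ball x r" "\<lambda>y. \<bar>f y - avg \<mu> (ball x r) f\<bar>"]
    by (simp add: divide_le_eq)
  then show ?thesis
    using f by (simp add: BMO_def)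
qed

end

end

theorem theorem4p3:
  fixes \<mu> :: "'a::metric_space measure" and f :: "'a \<Rightarrow> real"
  assumes "borel_regular \<mu>"
    and "balls_pos_finite \<mu>"
    and "doubling \<mu>"
    and "f \<in> L1_loc \<mu>"
  shows "f \<in> BMO \<mu> \<longleftrightarrow>
    (\<exists>M::real. M \<ge> 0 \<and>
      (\<forall>lam::real. lam \<ge> 0 \<longrightarrow> (\<forall>x. \<forall>r>0.
        (LINT y:{y \<in> ball x r. \<bar>f y - avg \<mu> (ball x r) f\<bar> > lam}|\<mu>.
            \<bar>f y - avg \<mu> (ball x r) f\<bar>)
        \<le> (lam + M) * measure \<mu> {y \<in> ball x (3 * r). \<bar>f y - avg \<mu> (ball x r) f\<bar> > lam})))"
    (is "_ \<longleftrightarrow> (\<exists>M. M \<ge> 0 \<and> ?level M)")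
proof -
  obtain c where c: "1 \<le> c"
    "\<And>x r. 0 < r \<Longrightarrow> emeasure \<mu> (ball x (2 * r)) \<le> ennreal c * emeasure \<mu> (ball x r)"
    using \<open>doubling \<mu>\<close> by (auto simp: doubling_def)
  interpret doubling_space \<mu> c
    using assms c by unfold_locales
  show ?thesis
    unfolding BMO_iff[OF \<open>f \<in> L1_loc \<mu>\<close>]
  proof (intro iffI; elim exE conjE)
    fix M :: real
    assume M: "0 \<le> M" and osc: "\<forall>x. \<forall>r>0.
      (LINT y:ball x r|\<mu>. \<bar>f y - avg \<mu> (ball x r) f\<bar>) \<le> M * measure \<mu> (ball x r)"
    have "?level (6 * c ^ 3 * M)"
      using osc by (intro allI impI level_set_inequality[OF \<open>f \<in> L1_loc \<mu>\<close> M]) auto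
    moreover have "0 \<le> 6 * c ^ 3 * M"
      using M \<open>1 \<le> c\<close> by simp
    ultimately show "\<exists>M\<ge>0. ?level M" by blast
  next
    fix M :: real
    assume M: "0 \<le> M" and level: "?level M"
    have "(LINT y:ball x r|\<mu>. \<bar>f y - avg \<mu> (ball x r) f\<bar>) \<le> M * c ^ 2 * measure \<mu> (ball x r)"
      if r: "0 < r" for x r
    proof -
      define a where "a = avg \<mu> (ball x r) f"
      \<comment> \<open>Points with zero deviation contribute nothing, so level 0 captures the whole
        oscillation.\<close>
      have "(LINT y:ball x r|\<mu>. \<bar>f y - a\<bar>) = (LINT y:{y \<in> ball x r. \<bar>f y - a\<bar> > 0}|\<mu>. \<bar>f y - a\<bar>)"
        unfolding set_lebesgue_integral_def
        by (intro Bochner_Integration.integral_cong) (auto simp: indicator_def)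
      also have "\<dots> \<le> M * measure \<mu> {y \<in> ball x (3 * r). \<bar>f y - a\<bar> > 0}"
        using level[rule_format, of 0 r x] r by (simp add: a_def)
      \<comment> \<open>The tripled ball is enlarged to the quadrupled one, which two doublings
        reach at cost \<open>c ^ 2\<close>.\<close>
      also have "\<dots> \<le> M * measure \<mu> (ball x (2 ^ 2 * r))"
        using r M
        by (intro mult_left_mono measure_mono_fmeasurable
            level_set_in_sets[OF \<open>f \<in> L1_loc \<mu>\<close>]) auto
      also have "\<dots> \<le> M * (c ^ 2 * measure \<mu> (ball x r))"
        using r M by (intro mult_left_mono measure_double_power)
      finally show ?thesis
        by (simp add: a_def mult.assoc)
    qed
    moreover have "0 \<le> M * c ^ 2"
      using M by simp
    ultimately show "\<exists>M\<ge>0. \<forall>x. \<forall>r>0.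
        (LINT y:ball x r|\<mu>. \<bar>f y - avg \<mu> (ball x r) f\<bar>) \<le> M * measure \<mu> (ball x r)"
      by blast
  qed
qed

end
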